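(* In the VI setting below, let $(u_k,\Delta_k)\subset\mathbb{R}^n\times(0,\infty)$ with $u_k\to u$ and $\Delta_k\to0$. Then there exists $K\in\mathbb{N}$ such that $\mathcal P(u_k,\Delta_k)\subseteq\mathcal B(u)$ and $\mathcal G(u_k,\Delta_k)\subseteq\partial_BS(u)$ for all $k\ge K$. In particular, $\sup_{G\in\mathcal G(u_k,\Delta_k)}\inf_{W\in\partial_BS(u)}\|G-W\|\to0$.
   Context: VI setting: $A\in\mathbb{R}^{n\times n}$ symmetric positive definite with smallest/largest eigenvalues $\lambda_{\min},\lambda_{\max}$; $\|v\|_1=\sum_i|v_i|$. For $u\in\mathbb{R}^n$, $S(u)=y$ is the unique solution of $\langle Ay,v-y\rangle+\|v\|_1-\|y\|_1\ge\langle u,v-y\rangle$ for all $v$; equivalently there is $q$ with $Ay+q=u$, $y_iq_i=|y_i|$, $|q_i|\le1$, and then $q=u-Ay$. $S$ is globally Lipschitz. Index sets (for $y=S(u)$, $q=u-Ay$): $\mathcal A_s(u)=\{i:|q_i|<1\}$, $\mathcal I(u)=\{i:y_i\neq0\}$, $\mathcal B(u)=\{i:y_i=0,|q_i|=1\}$. Let $L_y=1/\lambda_{\min}$, $L_q=\lambda_{\max}/\lambda_{\min}+1$. Possibly biactive indices: $\mathcal P(u,\Delta):=\{i: |y_i|<L_y\Delta \text{ and } ||q_i|-1|<L_q\Delta\}$. For $\mathcal N\subseteq\{1,\dots,n\}$: $A(\mathcal N)_{ij}=A_{ij}$ if $i,j\notin\mathcal N$, $A(\mathcal N)_{ij}=0$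 if $i\ne j$ and ($i\in\mathcal N$ or $j\in\mathcal N$), $A(\mathcal N)_{ii}=1$ if $i\in\mathcal N$; $\chi(\mathcal N)$ is diagonal with $\chi(\mathcal N)_{ii}=1$ for $i\notin\mathcal N$, $0$ otherwise. Define $\mathcal G(u,\Delta):=\{A(\mathcal A_s(u)\cup\mathcal B_0)^{-1}\chi(\mathcal A_s(u)\cup\mathcal B_0):\mathcal B_0\subseteq\mathcal P(u,\Delta)\}$. $\partial_BS(u)$: all limits $\lim_jS'(u_j)$ with $u_j\to u$ and $S$ differentiable at $u_j$. *)

theory Defs
  imports "HOL-Analysis.Analysis"
begin

type_synonym 'n vec = "real ^ 'n"
type_synonym 'n mat = "real ^ 'n ^ 'n"

definition sym_pos_def_mat :: "'n::finite mat \<Rightarrow> bool" where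
  "sym_pos_def_mat A \<longleftrightarrow> transpose A = A \<and> (\<forall>x. x \<noteq> 0 \<longrightarrow> x \<bullet> (A *v x) > 0)"

definition eigenvalues_mat :: "'n::finite mat \<Rightarrow> real set" where
  "eigenvalues_mat A = {c. \<exists>v. v \<noteq> 0 \<and> A *v v = c *\<^sub>R v}"

definition lam_min :: "'n::finite mat \<Rightarrow> real" where
  "lam_min A = Min (eigenvalues_mat A)"

definition lam_max :: "'n::finite mat \<Rightarrow> real" where
  "lam_max A = Max (eigenvalues_mat A)"

definition norm1 :: "'n::finite vec \<Rightarrow> real" where
  "norm1 v = (\<Sum>i\<in>UNIV. \<bar>v $ i\<bar>)"

text \<open>The variational inequality defining S(u).\<close>
definition VI_sol :: "'n::finite mat \<Rightarrow> 'n vec \<Rightarrow> 'n vec \<Rightarrow> bool" where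
  "VI_sol A u y \<longleftrightarrow>
     (\<forall>v. (A *v y) \<bullet> (v - y) + norm1 v - norm1 y \<ge> u \<bullet> (v - y))"

definition Ssol :: "'n::finite mat \<Rightarrow> 'n vec \<Rightarrow> 'n vec" where
  "Ssol A u = (THE y. VI_sol A u y)"

definition qmult :: "'n::finite mat \<Rightarrow> 'n vec \<Rightarrow> 'n vec" where
  "qmult A u = u - A *v Ssol A u"

definition strict_act :: "'n::finite mat \<Rightarrow> 'n vec \<Rightarrow> 'n set" where
  "strict_act A u = {i. \<bar>qmult A u $ i\<bar> < 1}"

definition inact :: "'n::finite mat \<Rightarrow> 'n vec \<Rightarrow> 'n set" where
  "inact A u = {i. Ssol A u $ i \<noteq> 0}"

definition biact :: "'n::finite mat \<Rightarrow> 'n vec \<Rightarrow> 'n set" where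
  "biact A u = {i. Ssol A u $ i = 0 \<and> \<bar>qmult A u $ i\<bar> = 1}"

definition L_y :: "'n::finite mat \<Rightarrow> real" where
  "L_y A = 1 / lam_min A"

definition L_q :: "'n::finite mat \<Rightarrow> real" where
  "L_q A = lam_max A / lam_min A + 1"

definition poss_biact :: "'n::finite mat \<Rightarrow> 'n vec \<Rightarrow> real \<Rightarrow> 'n set" where
  "poss_biact A u d = {i. \<bar>Ssol A u $ i\<bar> < L_y A * d \<and>
                               \<bar>\<bar>qmult A u $ i\<bar> - 1\<bar> < L_q A * d}"

definition A_red :: "'n::finite mat \<Rightarrow> 'n set \<Rightarrow> 'n mat" where
  "A_red A N = (\<chi> i j. if i \<notin> N \<and> j \<notin> N then A $ i $ j
                        else if i = j then 1 else 0)"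

definition chi_mat :: "'n::finite set \<Rightarrow> 'n mat" where
  "chi_mat N = (\<chi> i j. if i = j \<and> i \<notin> N then 1 else 0)"

definition Gset :: "'n::finite mat \<Rightarrow> 'n vec \<Rightarrow> real \<Rightarrow> 'n mat set" where
  "Gset A u d = {matrix_inv (A_red A (strict_act A u \<union> B0)) ** chi_mat (strict_act A u \<union> B0)
                   | B0. B0 \<subseteq> poss_biact A u d}"

text \<open>Bouligand subdifferential: limits of Jacobians at points of differentiability.\<close>
definition bouligand :: "('n::finite vec \<Rightarrow> 'n vec) \<Rightarrow> 'n vec \<Rightarrow> 'n mat set" where
  "bouligand S u = {W. \<exists>uj :: nat \<Rightarrow> 'n vec. uj \<longlonglongrightarrow> u \<and> (\<forall>j. S differentiable (at (uj j))) \<and>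
        (\<lambda>j. matrix (frechet_derivative S (at (uj j)))) \<longlonglongrightarrow> W}"

end

theory Submission
  imports Defs
begin

text \<open>Where no index is biactive, the VI solution map S is locally affine: keeping the strictly
  active set N and the signs of the inactive entries fixed, S(v) = S(x) + M_N (v - x) with
  M_N = A(N)^-1 chi(N), so S'(x) = M_N. Conversely, for every N between the strictly active set of u
  and the zero set of S(u), moving u along a suitable direction h makes N exactly strictly active
  without biactivity; hence M_N is a limit of Jacobians, i.e. lies in the Bouligand subdifferential.
  By continuity of (S, q), for u_k near u and small Delta_k the possibly biactive indices of u_k are
  biactive at u and every index set used in G(u_k, Delta_k) lies in that range.\<close>

definition norm1_subgradient :: "'n::finite vec \<Rightarrow> 'n vec \<Rightarrow> bool" where
  "norm1_subgradient q y \<longleftrightarrow> (\<forall>i. \<bar>q $ i\<bar> \<le> 1 \<and> q $ i * y $ i = \<bar>y $ i\<bar>)"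

lemma norm1_nonneg: "0 \<le> norm1 y"
  unfolding norm1_def by (simp add: sum_nonneg)

lemma norm1_add_axis: "norm1 (y + axis i s) = norm1 y - \<bar>y $ i\<bar> + \<bar>y $ i + s\<bar>"
proof -
  have "norm1 (y + axis i s) = \<bar>y $ i + s\<bar> + (\<Sum>j\<in>UNIV - {i}. \<bar>y $ j\<bar>)"
    unfolding norm1_def by (subst sum.remove[of _ i]) (auto simp: axis_def intro!: sum.cong)
  moreover have "norm1 y = \<bar>y $ i\<bar> + (\<Sum>j\<in>UNIV - {i}. \<bar>y $ j\<bar>)"
    unfolding norm1_def by (subst sum.remove[of _ i]) auto
  ultimately show ?thesis by simp
qed

lemma norm1_convex:
  assumes "0 \<le> s" "s \<le> 1"
  shows "norm1 ((1 - s) *\<^sub>R y + s *\<^sub>R v) \<le> (1 - s) * norm1 y + s * norm1 v"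
proof -
  have "\<bar>(1 - s) * y $ i + s * v $ i\<bar> \<le> (1 - s) * \<bar>y $ i\<bar> + s * \<bar>v $ i\<bar>" for i
    using abs_triangle_ineq[of "(1 - s) * y $ i" "s * v $ i"] assms by (simp add: abs_mult)
  then have "norm1 ((1 - s) *\<^sub>R y + s *\<^sub>R v) \<le> (\<Sum>i\<in>UNIV. (1 - s) * \<bar>y $ i\<bar> + s * \<bar>v $ i\<bar>)"
    unfolding norm1_def by (simp add: sum_mono)
  also have "\<dots> = (1 - s) * norm1 y + s * norm1 v"
    by (simp add: norm1_def sum.distrib sum_distrib_left)
  finally show ?thesis .
qed

lemma norm1_subgradient_iff:
  "norm1_subgradient q y \<longleftrightarrow> (\<forall>v. q \<bullet> (v - y) \<le> norm1 v - norm1 y)"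
proof
  assume sub: "norm1_subgradient q y"
  show "\<forall>v. q \<bullet> (v - y) \<le> norm1 v - norm1 y"
  proof
    fix v
    have "q $ i * v $ i - q $ i * y $ i \<le> \<bar>v $ i\<bar> - \<bar>y $ i\<bar>" for i
    proof -
      have "q $ i * v $ i \<le> \<bar>q $ i\<bar> * \<bar>v $ i\<bar>" by (metis abs_ge_self abs_mult)
      also have "\<dots> \<le> \<bar>v $ i\<bar>" using sub by (simp add: norm1_subgradient_def mult_left_le_one_le)
      finally show ?thesis using sub by (simp add: norm1_subgradient_def)
    qed
    then show "q \<bullet> (v - y) \<le> norm1 v - norm1 y"
      unfolding inner_vec_def norm1_def
      by (simp add: right_diff_distrib sum_subtractf[symmetric] sum_mono)
  qed
next
  assume sub: "\<forall>v. q \<bullet> (v - y) \<le> norm1 v - norm1 y"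
  have axis: "q $ i * s \<le> \<bar>y $ i + s\<bar> - \<bar>y $ i\<bar>" for i s
    using sub[rule_format, of "y + axis i s"] by (simp add: norm1_add_axis inner_axis)
  show "norm1_subgradient q y"
    unfolding norm1_subgradient_def
  proof
    fix i
    have "q $ i \<le> 1" "- q $ i \<le> 1" "\<bar>y $ i\<bar> \<le> q $ i * y $ i"
      using axis[of i 1] axis[of i "-1"] axis[of i "- y $ i"] by (auto simp: abs_if split: if_splits)
    moreover have "q $ i * y $ i \<le> \<bar>q $ i\<bar> * \<bar>y $ i\<bar>" by (metis abs_ge_self abs_mult)
    ultimately show "\<bar>q $ i\<bar> \<le> 1 \<and> q $ i * y $ i = \<bar>y $ i\<bar>"
      by (smt (verit, best) mult_left_le_one_le abs_ge_zero)
  qed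
qed

lemma norm1_subgradient_zero:
  assumes "norm1_subgradient q y" "\<bar>q $ i\<bar> < 1"
  shows "y $ i = 0"
proof -
  have "\<bar>y $ i\<bar> = \<bar>q $ i\<bar> * \<bar>y $ i\<bar>"
    using assms(1) by (metis norm1_subgradient_def abs_mult abs_abs)
  then show ?thesis using assms(2) by (auto simp: mult_less_cancel_right2)
qed

lemma VI_sol_iff_norm1_subgradient:
  "VI_sol A u y \<longleftrightarrow> norm1_subgradient (u - A *v y) y"
  unfolding VI_sol_def norm1_subgradient_iff by (simp add: inner_diff_left algebra_simps)

lemma VI_sol_monotone:
  assumes "VI_sol A u1 y1" "VI_sol A u2 y2"
  shows "(y1 - y2) \<bullet> (A *v (y1 - y2)) \<le> (u1 - u2) \<bullet> (y1 - y2)"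
proof -
  have "(u1 - A *v y1) \<bullet> (y2 - y1) \<le> norm1 y2 - norm1 y1"
       "(u2 - A *v y2) \<bullet> (y1 - y2) \<le> norm1 y1 - norm1 y2"
    using assms unfolding VI_sol_iff_norm1_subgradient norm1_subgradient_iff by blast+
  moreover have "(u1 - A *v y1) \<bullet> (y2 - y1) + (u2 - A *v y2) \<bullet> (y1 - y2)
      = (y1 - y2) \<bullet> (A *v (y1 - y2)) - (u1 - u2) \<bullet> (y1 - y2)"
    by (simp add: matrix_vector_mult_diff_distrib inner_diff_left inner_diff_right inner_commute algebra_simps)
  ultimately show ?thesis by linarith
qed

lemma sym_pos_def_mat_coercive:
  assumes "sym_pos_def_mat A"
  obtains c where "c > 0" "\<And>x. c * (norm x)\<^sup>2 \<le> x \<bullet> (A *v x)"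
proof -
  obtain x0 where x0: "norm x0 = 1" "\<And>y. norm y = 1 \<Longrightarrow> x0 \<bullet> (A *v x0) \<le> y \<bullet> (A *v y)"
    using continuous_attains_inf[of "sphere (0::real^'a) 1" "\<lambda>x. x \<bullet> (A *v x)"]
    by (fastforce intro!: continuous_intros simp: sphere_eq_empty)
  have "x0 \<noteq> 0" using x0 by auto
  then have pos: "x0 \<bullet> (A *v x0) > 0" using assms unfolding sym_pos_def_mat_def by auto
  have "(x0 \<bullet> (A *v x0)) * (norm x)\<^sup>2 \<le> x \<bullet> (A *v x)" for x
  proof (cases "x = 0")
    case False
    have "x0 \<bullet> (A *v x0) \<le> ((1 / norm x) *\<^sub>R x) \<bullet> (A *v ((1 / norm x) *\<^sub>R x))"
      using False by (intro x0(2)) simp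
    also have "\<dots> = (x \<bullet> (A *v x)) / (norm x)\<^sup>2"
      by (simp add: matrix_vector_mult_scaleR power2_eq_square)
    finally show ?thesis using False by (simp add: field_simps)
  qed simp
  then show ?thesis using pos that by blast
qed

lemma sym_pos_def_mat_inner_commute:
  assumes "sym_pos_def_mat A"
  shows "x \<bullet> (A *v y) = (A *v x) \<bullet> y"
  by (metis assms dot_lmul_matrix sym_pos_def_mat_def transpose_matrix_vector)

lemma nonneg_if_nonneg_along_right_segment:
  fixes B K :: real
  assumes "\<And>s. 0 < s \<Longrightarrow> s \<le> 1 \<Longrightarrow> 0 \<le> B + s * K"
  shows "0 \<le> B"
proof (rule tendsto_lowerbound)
  show "((\<lambda>s. B + s * K) \<longlongrightarrow> B) (at_right 0)"
    by (auto intro!: tendsto_eq_intros)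
  show "\<forall>\<^sub>F s in at_right 0. 0 \<le> B + s * K"
    unfolding eventually_at_right_field using assms by (auto intro!: exI[of _ 1])
qed simp

definition VI_energy :: "'n::finite mat \<Rightarrow> 'n vec \<Rightarrow> 'n vec \<Rightarrow> real" where
  "VI_energy A u y = y \<bullet> (A *v y) / 2 + norm1 y - u \<bullet> y"

lemma continuous_attains_min_if_large_outside_ball:
  fixes f :: "'a::{heine_borel, real_normed_vector} \<Rightarrow> real"
  assumes "continuous_on UNIV f" "\<And>y. R < norm y \<Longrightarrow> f 0 \<le> f y"
  obtains y0 where "\<And>y. f y0 \<le> f y"
proof -
  obtain y0 where y0: "y0 \<in> cball 0 \<bar>R\<bar>" "\<And>y. y \<in> cball 0 \<bar>R\<bar> \<Longrightarrow> f y0 \<le> f y"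
    using continuous_attains_inf[OF compact_cball, of 0 "\<bar>R\<bar>" f] assms(1)
    by (fastforce intro: continuous_on_subset)
  have "f y0 \<le> f 0" using y0(2)[of 0] by simp
  have "f y0 \<le> f y" for y
  proof (cases "norm y \<le> \<bar>R\<bar>")
    case False
    then have "R < norm y" by linarith
    then show ?thesis using assms(2) \<open>f y0 \<le> f 0\<close> by fastforce
  qed (use y0(2) in simp)
  then show ?thesis using that by blast
qed

lemma VI_energy_has_minimizer:
  assumes "sym_pos_def_mat A"
  obtains y where "\<And>v. VI_energy A u y \<le> VI_energy A u v"
proof -
  obtain c where c: "c > 0" "\<And>x. c * (norm x)\<^sup>2 \<le> x \<bullet> (A *v x)"
    using sym_pos_def_mat_coercive[OF assms] by blast
  have "VI_energy A u 0 \<le> VI_energy A u y" if "2 * norm u / c < norm y" for y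
  proof -
    have "0 \<le> norm y * (c * norm y / 2 - norm u)"
      using that c(1) by (intro mult_nonneg_nonneg) (auto simp: field_simps)
    also have "\<dots> \<le> VI_energy A u y"
      using c(2)[of y] norm1_nonneg[of y] norm_cauchy_schwarz[of u y]
      by (simp add: VI_energy_def power2_eq_square algebra_simps)
    finally show ?thesis by (simp add: VI_energy_def norm1_def)
  qed
  moreover have "continuous_on UNIV (VI_energy A u)"
    unfolding VI_energy_def norm1_def by (intro continuous_intros) auto
  ultimately show ?thesis
    using continuous_attains_min_if_large_outside_ball that by blast
qed

text \<open>First-order optimality along the segment from the minimizer y to v: the quadratic part of
  the energy contributes only O(s^2), and norm1 is convex.\<close>
lemma VI_energy_minimizer_VI_sol:
  assumes PD: "sym_pos_def_mat A" and min: "\<And>v. VI_energy A u y \<le> VI_energy A u v"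
  shows "VI_sol A u y"
  unfolding VI_sol_def
proof
  fix v
  define w where "w = v - y"
  define B where "B = (A *v y) \<bullet> w + norm1 v - norm1 y - u \<bullet> w"
  have "0 \<le> B + s * (w \<bullet> (A *v w) / 2)" if s: "0 < s" "s \<le> 1" for s
  proof -
    have quad: "(y + s *\<^sub>R w) \<bullet> (A *v (y + s *\<^sub>R w))
        = y \<bullet> (A *v y) + 2 * s * ((A *v y) \<bullet> w) + s\<^sup>2 * (w \<bullet> (A *v w))"
      using sym_pos_def_mat_inner_commute[OF PD, of w y]
      by (simp add: matrix_vector_right_distrib matrix_vector_mult_scaleR inner_add_left
          inner_add_right inner_commute power2_eq_square algebra_simps)
    have "VI_energy A u (y + s *\<^sub>R w) - VI_energy A u y
        = s * ((A *v y) \<bullet> w - u \<bullet> w) + s * (s * (w \<bullet> (A *v w) / 2)) + norm1 (y + s *\<^sub>R w) - norm1 y"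
      unfolding VI_energy_def quad by (simp add: inner_add_right power2_eq_square algebra_simps)
    also have "\<dots> \<le> s * B + s * (s * (w \<bullet> (A *v w) / 2))"
      using norm1_convex[of s y v] s by (simp add: B_def w_def algebra_simps)
    finally have "0 \<le> s * (B + s * (w \<bullet> (A *v w) / 2))"
      using min[of "y + s *\<^sub>R w"] by (simp add: distrib_left)
    then show ?thesis using s by (simp add: zero_le_mult_iff)
  qed
  then have "0 \<le> B" by (rule nonneg_if_nonneg_along_right_segment)
  then show "u \<bullet> (v - y) \<le> (A *v y) \<bullet> (v - y) + norm1 v - norm1 y"
    unfolding B_def w_def by linarith
qed

lemma VI_sol_unique:
  assumes PD: "sym_pos_def_mat A" and "VI_sol A u y1" "VI_sol A u y2"
  shows "y1 = y2"
proof -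
  have "(y1 - y2) \<bullet> (A *v (y1 - y2)) \<le> 0"
    using VI_sol_monotone[OF assms(2,3)] by simp
  then show ?thesis using PD unfolding sym_pos_def_mat_def by (metis eq_iff_diff_eq_0 not_le)
qed

lemma Ssol_eqI:
  assumes "sym_pos_def_mat A" "VI_sol A u y"
  shows "Ssol A u = y"
  unfolding Ssol_def using assms VI_sol_unique by blast

lemma VI_sol_Ssol:
  assumes "sym_pos_def_mat A"
  shows "VI_sol A u (Ssol A u)"
proof -
  obtain y where "\<And>v. VI_energy A u y \<le> VI_energy A u v"
    using VI_energy_has_minimizer[OF assms] by blast
  then have "VI_sol A u y" by (rule VI_energy_minimizer_VI_sol[OF assms])
  then show ?thesis using Ssol_eqI[OF assms] by simp
qed

lemma norm1_subgradient_qmult: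
  assumes "sym_pos_def_mat A"
  shows "norm1_subgradient (qmult A u) (Ssol A u)"
  using VI_sol_Ssol[OF assms] unfolding VI_sol_iff_norm1_subgradient qmult_def .

lemma Ssol_lipschitz:
  assumes PD: "sym_pos_def_mat A"
  obtains L where "L-lipschitz_on UNIV (Ssol A)"
proof -
  obtain c where c: "c > 0" "\<And>x. c * (norm x)\<^sup>2 \<le> x \<bullet> (A *v x)"
    using sym_pos_def_mat_coercive[OF PD] by blast
  have "norm (Ssol A u1 - Ssol A u2) \<le> (1 / c) * norm (u1 - u2)" for u1 u2
  proof -
    define d where "d = Ssol A u1 - Ssol A u2"
    have "c * (norm d)\<^sup>2 \<le> (u1 - u2) \<bullet> d"
      using c(2)[of d] VI_sol_monotone[OF VI_sol_Ssol[OF PD] VI_sol_Ssol[OF PD], of u1 u2]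
      unfolding d_def by linarith
    also have "\<dots> \<le> norm (u1 - u2) * norm d" by (rule norm_cauchy_schwarz)
    finally have "norm d * (c * norm d) \<le> norm d * norm (u1 - u2)"
      by (simp add: power2_eq_square algebra_simps)
    then show ?thesis
      using c(1) by (cases "norm d = 0") (auto simp: d_def field_simps)
  qed
  then have "(1 / c)-lipschitz_on UNIV (Ssol A)"
    using c(1) by (intro lipschitz_onI) (auto simp: dist_norm)
  then show ?thesis by (rule that)
qed

lemma isCont_Ssol:
  assumes "sym_pos_def_mat A"
  shows "isCont (Ssol A) u"
  using Ssol_lipschitz[OF assms]
  by (metis lipschitz_on_continuous_on continuous_on_eq_continuous_at open_UNIV UNIV_I)

lemma isCont_qmult:
  assumes "sym_pos_def_mat A"
  shows "isCont (qmult A) u"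
  unfolding qmult_def[abs_def]
  by (intro continuous_intros bounded_linear.continuous[OF matrix_vector_mul_bounded_linear]
      isCont_Ssol[OF assms])

lemma A_red_mult:
  "(A_red A N *v x) $ i = (if i \<in> N then x $ i else (\<Sum>j\<in>UNIV. if j \<notin> N then A $ i $ j * x $ j else 0))"
  unfolding matrix_vector_mult_def A_red_def
  by (auto simp: if_distrib[where f = "\<lambda>a. a * _"] sum.delta cong: if_cong intro!: sum.cong)

lemma chi_mat_mult: "(chi_mat N *v w) $ i = (if i \<in> N then 0 else w $ i)"
  unfolding matrix_vector_mult_def chi_mat_def
  by (simp add: if_distrib[where f = "\<lambda>a. a * _"] sum.delta cong: if_cong)

lemma A_red_invertible:
  assumes "sym_pos_def_mat A"
  shows "invertible (A_red A N)"
proof -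
  have "x = 0" if x: "A_red A N *v x = 0" for x
  proof -
    have xN: "x $ i = 0" if "i \<in> N" for i
      using arg_cong[OF x, of "\<lambda>z. z $ i"] that by (simp add: A_red_mult)
    have Ax: "(A *v x) $ i = 0" if "i \<notin> N" for i
    proof -
      have "(A *v x) $ i = (\<Sum>j\<in>UNIV. if j \<notin> N then A $ i $ j * x $ j else 0)"
        unfolding matrix_vector_mult_def using xN by (auto intro!: sum.cong)
      also have "\<dots> = 0" using arg_cong[OF x, of "\<lambda>z. z $ i"] that by (simp add: A_red_mult)
      finally show ?thesis .
    qed
    have "x $ i * (A *v x) $ i = 0" for i
      using xN Ax by (cases "i \<in> N") auto
    then have "x \<bullet> (A *v x) = 0"
      unfolding inner_vec_def by (auto intro: sum.neutral)
    then show ?thesis using assms unfolding sym_pos_def_mat_def by force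
  qed
  then show ?thesis
    using invertible_left_inverse matrix_left_invertible_ker by blast
qed

lemma matrix_inv_right:
  assumes "invertible M"
  shows "M ** matrix_inv M = mat 1"
  using assms unfolding invertible_def matrix_inv_def by (rule someI2_ex) blast

lemma reduced_inverse_mult:
  fixes A :: "'n::finite mat" and N :: "'n set" and w :: "'n vec"
  assumes PD: "sym_pos_def_mat A"
  defines "d \<equiv> (matrix_inv (A_red A N) ** chi_mat N) *v w"
  shows reduced_inverse_mult_in: "i \<in> N \<Longrightarrow> d $ i = 0"
    and reduced_inverse_mult_notin: "i \<notin> N \<Longrightarrow> (A *v d) $ i = w $ i"
proof -
  have red: "A_red A N *v d = chi_mat N *v w"
    using matrix_inv_right[OF A_red_invertible[OF PD]]
    by (simp add: d_def matrix_vector_mul_assoc matrix_mul_assoc)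
  show dN: "d $ i = 0" if "i \<in> N" for i
    using arg_cong[OF red, of "\<lambda>z. z $ i"] that by (simp add: A_red_mult chi_mat_mult)
  show "(A *v d) $ i = w $ i" if "i \<notin> N"
  proof -
    have "(A *v d) $ i = (\<Sum>j\<in>UNIV. if j \<notin> N then A $ i $ j * d $ j else 0)"
      unfolding matrix_vector_mult_def[of A] using dN by (auto intro!: sum.cong)
    also have "\<dots> = w $ i"
      using arg_cong[OF red, of "\<lambda>z. z $ i"] that by (simp add: A_red_mult chi_mat_mult)
    finally show ?thesis .
  qed
qed

lemma strict_act_subset_zeros:
  assumes "sym_pos_def_mat A"
  shows "strict_act A u \<subseteq> {i. Ssol A u $ i = 0}"
  using norm1_subgradient_zero[OF norm1_subgradient_qmult[OF assms]] by (auto simp: strict_act_def)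

lemma sign_stable_under_small_perturbation:
  fixes q y d :: real
  assumes "\<bar>q\<bar> = 1" "q * y = \<bar>y\<bar>" "\<bar>d\<bar> < \<bar>y\<bar>"
  shows "q * (y + d) = \<bar>y + d\<bar>"
  using assms by (cases "q = 1") (auto simp: abs_if split: if_splits)

text \<open>Without biactive indices, the candidate y + M (v - x) keeps the sign pattern of y off the
  strictly active set and stays strictly active on it for v near x, so it solves the VI there.\<close>
lemma Ssol_eventually_affine:
  fixes A :: "'n::finite mat" and x :: "'n vec"
  assumes PD: "sym_pos_def_mat A" and no_biact: "biact A x = {}"
  defines "N \<equiv> strict_act A x"
  defines "M \<equiv> matrix_inv (A_red A N) ** chi_mat N"
  shows "\<forall>\<^sub>F v in at x. Ssol A v = Ssol A x + M *v (v - x)"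
proof -
  define y where "y = Ssol A x"
  define q where "q = qmult A x"
  define g where "g v = y + M *v (v - x)" for v
  have sub: "norm1_subgradient q y"
    unfolding q_def y_def by (rule norm1_subgradient_qmult[OF PD])
  have yN: "y $ i = 0" if "i \<in> N" for i
    using that strict_act_subset_zeros[OF PD] by (auto simp: N_def y_def)
  have offN: "\<bar>q $ i\<bar> = 1 \<and> y $ i \<noteq> 0" if "i \<notin> N" for i
  proof -
    have "\<bar>q $ i\<bar> \<le> 1" "\<not> \<bar>q $ i\<bar> < 1"
      using that sub by (auto simp: N_def strict_act_def norm1_subgradient_def q_def)
    then have "\<bar>q $ i\<bar> = 1" by linarith
    moreover have "y $ i \<noteq> 0"
      using calculation no_biact by (auto simp: biact_def q_def y_def)
    ultimately show ?thesis ..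
  qed
  have gN: "g v $ i = 0" if "i \<in> N" for v i
    using that yN reduced_inverse_mult_in[OF PD] by (simp add: g_def M_def)
  have q_offN: "(v - A *v g v) $ i = q $ i" if "i \<notin> N" for v i
    using reduced_inverse_mult_notin[OF PD that, of "v - x"]
    by (simp add: g_def M_def q_def qmult_def y_def matrix_vector_right_distrib)
  have solves: "Ssol A v = g v"
    if "\<forall>i. (i \<in> N \<longrightarrow> \<bar>(v - A *v g v) $ i\<bar> < 1) \<and> (i \<notin> N \<longrightarrow> \<bar>(M *v (v - x)) $ i\<bar> < \<bar>y $ i\<bar>)"
    for v
  proof (rule Ssol_eqI[OF PD], unfold VI_sol_iff_norm1_subgradient norm1_subgradient_def, intro allI)
    fix i
    show "\<bar>(v - A *v g v) $ i\<bar> \<le> 1 \<and> (v - A *v g v) $ i * g v $ i = \<bar>g v $ i\<bar>"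
    proof (cases "i \<in> N")
      case True
      then show ?thesis using that gN by force
    next
      case False
      have "q $ i * g v $ i = \<bar>g v $ i\<bar>"
        using that False offN[OF False] sub
        by (auto simp: g_def norm1_subgradient_def intro: sign_stable_under_small_perturbation)
      then show ?thesis using q_offN[OF False] offN[OF False] by simp
    qed
  qed
  have "\<forall>\<^sub>F v in at x. \<forall>i. (i \<in> N \<longrightarrow> \<bar>(v - A *v g v) $ i\<bar> < 1) \<and>
                           (i \<notin> N \<longrightarrow> \<bar>(M *v (v - x)) $ i\<bar> < \<bar>y $ i\<bar>)"
  proof (intro eventually_all_finite allI eventually_conj)
    fix i
    have "isCont (\<lambda>v. \<bar>(v - A *v g v) $ i\<bar>) x" "isCont (\<lambda>v. \<bar>(M *v (v - x)) $ i\<bar>) x"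
      unfolding g_def
      by (intro continuous_intros bounded_linear.continuous[OF matrix_vector_mul_bounded_linear])+
    then have lim_q: "((\<lambda>v. \<bar>(v - A *v g v) $ i\<bar>) \<longlongrightarrow> \<bar>q $ i\<bar>) (at x)"
      and lim_d: "((\<lambda>v. \<bar>(M *v (v - x)) $ i\<bar>) \<longlongrightarrow> 0) (at x)"
      by (simp_all add: isCont_def g_def q_def qmult_def y_def)
    show "\<forall>\<^sub>F v in at x. i \<in> N \<longrightarrow> \<bar>(v - A *v g v) $ i\<bar> < 1"
    proof (cases "i \<in> N")
      case True
      then have "\<bar>q $ i\<bar> < 1" by (simp add: N_def q_def strict_act_def)
      from order_tendstoD(2)[OF lim_q this] show ?thesis by (rule eventually_mono) simp
    qed simp
    show "\<forall>\<^sub>F v in at x. i \<notin> N \<longrightarrow> \<bar>(M *v (v - x)) $ i\<bar> < \<bar>y $ i\<bar>"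
    proof (cases "i \<in> N")
      case False
      then have "0 < \<bar>y $ i\<bar>" using offN by simp
      from order_tendstoD(2)[OF lim_d this] show ?thesis by (rule eventually_mono) simp
    qed simp
  qed
  then have "\<forall>\<^sub>F v in at x. Ssol A v = g v"
    by (rule eventually_mono) (rule solves)
  then show ?thesis by (simp add: g_def y_def)
qed

lemma Ssol_has_derivative_if_no_biact:
  assumes "sym_pos_def_mat A" "biact A x = {}"
  shows "(Ssol A has_derivative
          (*v) (matrix_inv (A_red A (strict_act A x)) ** chi_mat (strict_act A x))) (at x)"
proof (rule has_derivative_transform_eventually)
  let ?M = "matrix_inv (A_red A (strict_act A x)) ** chi_mat (strict_act A x)"
  show "((\<lambda>v. Ssol A x + ?M *v (v - x)) has_derivative (*v) ?M) (at x)"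
    by (auto intro!: derivative_eq_intros
        bounded_linear.has_derivative[OF matrix_vector_mul_bounded_linear])
  show "\<forall>\<^sub>F v in at x. Ssol A x + ?M *v (v - x) = Ssol A v"
    using Ssol_eventually_affine[OF assms] by (simp add: eq_commute)
qed simp_all

text \<open>Moving u along A d + e with d = q off N and e = -q on N shifts (y, q) to
  (y + t d, q + t e): off N the zero entries of y become nonzero with the sign of q, and on N the
  multiplier is shrunk to (1 - t) q. Hence exactly N is strictly active and nothing is biactive.\<close>
lemma direction_realizing_strict_act:
  assumes PD: "sym_pos_def_mat A"
    and lower: "strict_act A u \<subseteq> N" and upper: "N \<subseteq> {i. Ssol A u $ i = 0}"
  obtains h where "\<And>t. 0 < t \<Longrightarrow> t < 1 \<Longrightarrow> strict_act A (u + t *\<^sub>R h) = N \<and> biact A (u + t *\<^sub>R h) = {}"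
proof -
  define y where "y = Ssol A u"
  define q where "q = qmult A u"
  define d :: "'a vec" where "d = (\<chi> i. if i \<in> N then 0 else q $ i)"
  define e :: "'a vec" where "e = (\<chi> i. if i \<in> N then - q $ i else 0)"
  have sub: "norm1_subgradient q y"
    unfolding q_def y_def by (rule norm1_subgradient_qmult[OF PD])
  have "strict_act A (u + t *\<^sub>R (A *v d + e)) = N \<and> biact A (u + t *\<^sub>R (A *v d + e)) = {}"
    if t: "0 < t" "t < 1" for t
  proof -
    let ?u = "u + t *\<^sub>R (A *v d + e)"
    define yt where "yt = y + t *\<^sub>R d"
    define qt where "qt = q + t *\<^sub>R e"
    have qt_eq: "qt = ?u - A *v yt"
      by (simp add: qt_def yt_def q_def y_def qmult_def matrix_vector_right_distrib algebra_simps)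
    have coord: "(i \<in> N \<longrightarrow> yt $ i = 0 \<and> \<bar>qt $ i\<bar> < 1) \<and>
                 (i \<notin> N \<longrightarrow> \<bar>qt $ i\<bar> = 1 \<and> qt $ i * yt $ i = \<bar>yt $ i\<bar> \<and> yt $ i \<noteq> 0)" for i
    proof (cases "i \<in> N")
      case True
      have "qt $ i = (1 - t) * q $ i"
        using True by (simp add: qt_def e_def algebra_simps)
      then have "\<bar>qt $ i\<bar> = (1 - t) * \<bar>q $ i\<bar>"
        using t by (simp add: abs_mult)
      also have "\<dots> \<le> 1 - t"
        using sub t by (intro mult_right_le_one_le) (auto simp: norm1_subgradient_def)
      also have "\<dots> < 1" using t by simp
      finally show ?thesis
        using True upper by (auto simp: yt_def d_def y_def)
    next
      case False
      have "\<bar>q $ i\<bar> \<le> 1" "\<not> \<bar>q $ i\<bar> < 1"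
        using False lower sub by (auto simp: strict_act_def norm1_subgradient_def q_def)
      then have q1: "\<bar>q $ i\<bar> = 1" by linarith
      then have "q $ i * q $ i = 1" by (cases "0 \<le> q $ i") auto
      then have "q $ i * yt $ i = \<bar>y $ i\<bar> + t"
        using False sub by (simp add: yt_def d_def norm1_subgradient_def algebra_simps)
      moreover have "\<bar>yt $ i\<bar> = \<bar>q $ i * yt $ i\<bar>" using q1 by (simp add: abs_mult)
      ultimately show ?thesis
        using False q1 t by (simp add: qt_def e_def)
    qed
    have "norm1_subgradient qt yt"
      unfolding norm1_subgradient_def
    proof
      fix i show "\<bar>qt $ i\<bar> \<le> 1 \<and> qt $ i * yt $ i = \<bar>yt $ i\<bar>"
        using coord[of i] by (cases "i \<in> N") auto
    qed
    then have Ssol: "Ssol A ?u = yt"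
      unfolding qt_eq by (intro Ssol_eqI[OF PD]) (simp add: VI_sol_iff_norm1_subgradient)
    then have qmult: "qmult A ?u = qt" by (simp add: qmult_def qt_eq)
    have "i \<in> strict_act A ?u \<longleftrightarrow> i \<in> N" for i
      using coord[of i] unfolding strict_act_def Ssol qmult by (cases "i \<in> N") auto
    moreover have "i \<notin> biact A ?u" for i
      using coord[of i] unfolding biact_def Ssol qmult by (cases "i \<in> N") auto
    ultimately show ?thesis by blast
  qed
  then show ?thesis using that by blast
qed

lemma reduced_inverse_in_bouligand:
  assumes PD: "sym_pos_def_mat A"
    and "strict_act A u \<subseteq> N" "N \<subseteq> {i. Ssol A u $ i = 0}"
  shows "matrix_inv (A_red A N) ** chi_mat N \<in> bouligand (Ssol A) u"
proof -
  let ?M = "matrix_inv (A_red A N) ** chi_mat N"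
  obtain h where h: "\<And>t. 0 < t \<Longrightarrow> t < 1 \<Longrightarrow>
      strict_act A (u + t *\<^sub>R h) = N \<and> biact A (u + t *\<^sub>R h) = {}"
    using direction_realizing_strict_act[OF assms] by blast
  define uj where "uj j = u + (1 / (2 + real j)) *\<^sub>R h" for j
  have deriv: "(Ssol A has_derivative (*v) ?M) (at (uj j))" for j
    using Ssol_has_derivative_if_no_biact[OF PD, of "uj j"] h[of "1 / (2 + real j)"]
    by (simp add: uj_def)
  have "(\<lambda>j. 1 / (2 + real j)) \<longlonglongrightarrow> 0"
    by (intro tendsto_divide_0[OF tendsto_const] filterlim_at_top_imp_at_infinity
        filterlim_tendsto_add_at_top[OF tendsto_const filterlim_real_sequentially])
  then have "(\<lambda>j. u + (1 / (2 + real j)) *\<^sub>R h) \<longlonglongrightarrow> u + 0 *\<^sub>R h"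
    by (intro tendsto_intros)
  then have "uj \<longlonglongrightarrow> u"
    by (simp add: uj_def[abs_def])
  moreover have "Ssol A differentiable (at (uj j))" for j
    using deriv unfolding differentiable_def by blast
  moreover have "matrix (frechet_derivative (Ssol A) (at (uj j))) = ?M" for j
    using frechet_derivative_at[OF deriv[of j], symmetric] by simp
  ultimately show ?thesis
    unfolding bouligand_def by (intro CollectI exI[of _ uj]) simp
qed

lemma Gset_subset_bouligand:
  assumes PD: "sym_pos_def_mat A"
    and strict: "strict_act A u \<subseteq> strict_act A v" and inact: "inact A u \<subseteq> inact A v"
    and poss: "poss_biact A v d \<subseteq> biact A u"
  shows "Gset A v d \<subseteq> bouligand (Ssol A) u"
proof
  fix G assume "G \<in> Gset A v d"
  then obtain B0 where B0: "B0 \<subseteq> poss_biact A v d"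
    and G: "G = matrix_inv (A_red A (strict_act A v \<union> B0)) ** chi_mat (strict_act A v \<union> B0)"
    unfolding Gset_def by blast
  have "strict_act A v \<subseteq> {i. Ssol A u $ i = 0}"
    using strict_act_subset_zeros[OF PD, of v] inact by (auto simp: inact_def)
  moreover have "B0 \<subseteq> {i. Ssol A u $ i = 0}"
    using B0 poss by (auto simp: biact_def)
  ultimately show "G \<in> bouligand (Ssol A) u"
    unfolding G using strict by (intro reduced_inverse_in_bouligand[OF PD]) auto
qed

lemma eventually_imp_const:
  assumes "P \<Longrightarrow> eventually Q F"
  shows "eventually (\<lambda>x. P \<longrightarrow> Q x) F"
  using assms by (cases P) (auto elim: eventually_mono)

lemma eventually_index_sets_nested:
  assumes PD: "sym_pos_def_mat A" and "uk \<longlonglongrightarrow> u" "\<Delta> \<longlonglongrightarrow> 0"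
  shows "\<forall>\<^sub>F k in sequentially. strict_act A u \<subseteq> strict_act A (uk k) \<and> inact A u \<subseteq> inact A (uk k)
           \<and> poss_biact A (uk k) (\<Delta> k) \<subseteq> biact A u"
proof -
  have y: "(\<lambda>k. \<bar>Ssol A (uk k) $ i\<bar>) \<longlonglongrightarrow> \<bar>Ssol A u $ i\<bar>"
    and q: "(\<lambda>k. \<bar>qmult A (uk k) $ i\<bar>) \<longlonglongrightarrow> \<bar>qmult A u $ i\<bar>" for i
    using tendsto_rabs[OF tendsto_vec_nth[OF isCont_tendsto_compose[OF isCont_Ssol[OF PD] assms(2)]]]
          tendsto_rabs[OF tendsto_vec_nth[OF isCont_tendsto_compose[OF isCont_qmult[OF PD] assms(2)]]] .
  have y_gap: "(\<lambda>k. \<bar>Ssol A (uk k) $ i\<bar> - L_y A * \<Delta> k) \<longlonglongrightarrow> \<bar>Ssol A u $ i\<bar>"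
    and q_gap: "(\<lambda>k. \<bar>\<bar>qmult A (uk k) $ i\<bar> - 1\<bar> - L_q A * \<Delta> k) \<longlonglongrightarrow> \<bar>\<bar>qmult A u $ i\<bar> - 1\<bar>" for i
    using tendsto_diff[OF y tendsto_mult_right_zero[OF assms(3)]]
          tendsto_diff[OF tendsto_rabs[OF tendsto_diff[OF q tendsto_const]] tendsto_mult_right_zero[OF assms(3)]]
    by simp_all
  have "\<forall>\<^sub>F k in sequentially. \<forall>i.
          (\<bar>qmult A u $ i\<bar> < 1 \<longrightarrow> \<bar>qmult A (uk k) $ i\<bar> < 1) \<and>
          (Ssol A u $ i \<noteq> 0 \<longrightarrow> 0 < \<bar>Ssol A (uk k) $ i\<bar>) \<and>
          (Ssol A u $ i \<noteq> 0 \<longrightarrow> 0 < \<bar>Ssol A (uk k) $ i\<bar> - L_y A * \<Delta> k) \<and>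
          (\<bar>qmult A u $ i\<bar> \<noteq> 1 \<longrightarrow> 0 < \<bar>\<bar>qmult A (uk k) $ i\<bar> - 1\<bar> - L_q A * \<Delta> k)"
  proof (intro eventually_all_finite allI eventually_conj)
    fix i
    show "\<forall>\<^sub>F k in sequentially. \<bar>qmult A u $ i\<bar> < 1 \<longrightarrow> \<bar>qmult A (uk k) $ i\<bar> < 1"
      by (rule eventually_imp_const, rule order_tendstoD(2)[OF q])
    show "\<forall>\<^sub>F k in sequentially. Ssol A u $ i \<noteq> 0 \<longrightarrow> 0 < \<bar>Ssol A (uk k) $ i\<bar>"
      by (rule eventually_imp_const, rule order_tendstoD(1)[OF y]) simp
    show "\<forall>\<^sub>F k in sequentially. Ssol A u $ i \<noteq> 0 \<longrightarrow> 0 < \<bar>Ssol A (uk k) $ i\<bar> - L_y A * \<Delta> k"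
      by (rule eventually_imp_const, rule order_tendstoD(1)[OF y_gap]) simp
    show "\<forall>\<^sub>F k in sequentially. \<bar>qmult A u $ i\<bar> \<noteq> 1 \<longrightarrow>
            0 < \<bar>\<bar>qmult A (uk k) $ i\<bar> - 1\<bar> - L_q A * \<Delta> k"
      by (rule eventually_imp_const, rule order_tendstoD(1)[OF q_gap]) simp
  qed
  then show ?thesis
  proof (rule eventually_mono, intro conjI subsetI)
    fix k i assume "\<forall>i. (\<bar>qmult A u $ i\<bar> < 1 \<longrightarrow> \<bar>qmult A (uk k) $ i\<bar> < 1) \<and>
          (Ssol A u $ i \<noteq> 0 \<longrightarrow> 0 < \<bar>Ssol A (uk k) $ i\<bar>) \<and>
          (Ssol A u $ i \<noteq> 0 \<longrightarrow> 0 < \<bar>Ssol A (uk k) $ i\<bar> - L_y A * \<Delta> k) \<and>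
          (\<bar>qmult A u $ i\<bar> \<noteq> 1 \<longrightarrow> 0 < \<bar>\<bar>qmult A (uk k) $ i\<bar> - 1\<bar> - L_q A * \<Delta> k)"
    then have H: "(\<bar>qmult A u $ i\<bar> < 1 \<longrightarrow> \<bar>qmult A (uk k) $ i\<bar> < 1) \<and>
          (Ssol A u $ i \<noteq> 0 \<longrightarrow> 0 < \<bar>Ssol A (uk k) $ i\<bar>) \<and>
          (Ssol A u $ i \<noteq> 0 \<longrightarrow> 0 < \<bar>Ssol A (uk k) $ i\<bar> - L_y A * \<Delta> k) \<and>
          (\<bar>qmult A u $ i\<bar> \<noteq> 1 \<longrightarrow> 0 < \<bar>\<bar>qmult A (uk k) $ i\<bar> - 1\<bar> - L_q A * \<Delta> k)"
      by blast
    then show "i \<in> strict_act A u \<Longrightarrow> i \<in> strict_act A (uk k)"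
      and "i \<in> inact A u \<Longrightarrow> i \<in> inact A (uk k)"
      by (auto simp: strict_act_def inact_def)
    assume "i \<in> poss_biact A (uk k) (\<Delta> k)"
    then have "\<not> 0 < \<bar>Ssol A (uk k) $ i\<bar> - L_y A * \<Delta> k"
      and "\<not> 0 < \<bar>\<bar>qmult A (uk k) $ i\<bar> - 1\<bar> - L_q A * \<Delta> k"
      by (simp_all add: poss_biact_def)
    with H show "i \<in> biact A u"
      by (auto simp: biact_def)
  qed
qed

lemma Sup_Inf_dist_eq_0_if_subset:
  fixes G W :: "'a::real_normed_vector set"
  assumes "G \<noteq> {}" "G \<subseteq> W"
  shows "Sup ((\<lambda>g. Inf ((\<lambda>w. norm (g - w)) ` W)) ` G) = 0"
proof -
  have "Inf ((\<lambda>w. norm (g - w)) ` W) = 0" if "g \<in> G" for g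
    using assms(2) that by (intro cInf_eq_minimum) auto
  then have "(\<lambda>g. Inf ((\<lambda>w. norm (g - w)) ` W)) ` G = {0}"
    using assms(1) by auto
  then show ?thesis by simp
qed

theorem lemma4p4:
  fixes A :: "real ^ 'n::finite ^ 'n" and u :: "real ^ 'n"
    and uk :: "nat \<Rightarrow> real ^ 'n" and \<Delta> :: "nat \<Rightarrow> real"
  assumes "sym_pos_def_mat A"
    and "\<And>k. \<Delta> k > 0"
    and "uk \<longlonglongrightarrow> u"
    and "\<Delta> \<longlonglongrightarrow> 0"
  shows "(\<exists>K. \<forall>k\<ge>K. poss_biact A (uk k) (\<Delta> k) \<subseteq> biact A u \<and>
                      Gset A (uk k) (\<Delta> k) \<subseteq> bouligand (Ssol A) u)
         \<and> (\<lambda>k. Sup ((\<lambda>G. Inf ((\<lambda>W. norm (G - W)) ` bouligand (Ssol A) u)) ` Gset A (uk k) (\<Delta> k)))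
             \<longlonglongrightarrow> 0"
proof -
  let ?dist = "\<lambda>k. Sup ((\<lambda>G. Inf ((\<lambda>W. norm (G - W)) ` bouligand (Ssol A) u)) ` Gset A (uk k) (\<Delta> k))"
  have nested: "\<forall>\<^sub>F k in sequentially. poss_biact A (uk k) (\<Delta> k) \<subseteq> biact A u \<and>
                  Gset A (uk k) (\<Delta> k) \<subseteq> bouligand (Ssol A) u"
    using eventually_index_sets_nested[OF assms(1,3,4)]
    by (rule eventually_mono) (simp add: Gset_subset_bouligand[OF assms(1)])
  have nonempty: "Gset A v d \<noteq> {}" for v d
    unfolding Gset_def by blast
  have "\<forall>\<^sub>F k in sequentially. ?dist k = 0"
    using nested by (rule eventually_mono) (simp add: Sup_Inf_dist_eq_0_if_subset nonempty)
  then have "?dist \<longlonglongrightarrow> 0"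
    by (rule tendsto_eventually)
  with nested show ?thesis
    unfolding eventually_sequentially by blast
qed

end
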